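(* Let $Q(t)\in\mathbb{H}[t]$ be a monic polynomial, written as $Q(t)=f(t)+\mathbf{k}\,g(t)$ with $f(t),g(t)\in\mathbb{C}[t]$, and write $f=f_1+f_2\mathbf{i}$, $g=g_1+g_2\mathbf{i}$ with $f_1,f_2,g_1,g_2\in\mathbb{R}[t]$. Put $\mathcal{H}_1=\min\{H(f),H(g)\}$ and $\mathcal{H}_2=\min\{H(f_1),H(f_2),H(g_1),H(g_2)\}$, where the minima are taken over those of the listed polynomials that are nonzero. Let $\rho\in\mathbb{H}$ be a root of $Q(t)$. If $\rho$ is a spherical root, then $$|\rho|<1+\mathcal{H}_2^{1/2}.$$ If $\rho$ is an isolated complex root, then $$|\rho|<1+\mathcal{H}_1.$$ In the general case (for every root $\rho$), $$|\rho|<1+H(Q).$$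
   Context: $\mathbb{H}$ is the skew field of real quaternions $x_0+x_1\mathbf{i}+x_2\mathbf{j}+x_3\mathbf{k}$ with norm $|q|=\sqrt{x_0^2+x_1^2+x_2^2+x_3^2}$, and $\mathbb{C}=\mathbb{R}+\mathbb{R}\mathbf{i}\subset\mathbb{H}$. In $\mathbb{H}[t]$ the variable $t$ commutes with the coefficients; for $P(t)=a_0t^n+a_1t^{n-1}+\cdots+a_n$ and $q\in\mathbb{H}$ the evaluation is $P(q)=a_0q^n+a_1q^{n-1}+\cdots+a_n$, and $q$ is a root of $P$ if $P(q)=0$. A complex root is a root lying in $\mathbb{C}$. Every $Q\in\mathbb{H}[t]$ is uniquely $f+\mathbf{k}g$ with $f,g\in\mathbb{C}[t]$. The congruence class of $q\in\mathbb{H}$ is $[q]=\{wqw^{-1}: w\in\mathbb{H}\setminus\{0\}\}=\{q'\in\mathbb{H}:\operatorname{Re}q'=\operatorname{Re}q,\ |q'|=|q|\}$. A root $q$ of $P\in\mathbb{H}[t]$ is called spherical if $q\notin\mathbb{R}$ and $P(r)=0$ for every $r\in[q]$; otherwise it is called isolated. The height of a nonzero polynomial $P(t)=a_0t^n+a_1t^{n-1}+\cdots+a_n\in\mathbb{H}[t]$ with $a_0\ne0$ is $H(P)=\max\{1,|a_1/a_0|,\dots,|a_n/a_0|\}$, where $|a_i/a_0|=|a_i|/|a_0|$. *)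

theory Defs
  imports "HOL-Analysis.Inner_Product" "HOL-Computational_Algebra.Polynomial"
begin

codatatype quat = Quat (qRe: real) (qI: real) (qJ: real) (qK: real)

lemma quat_eqI [intro?]: "qRe x = qRe y \<Longrightarrow> qI x = qI y \<Longrightarrow> qJ x = qJ y \<Longrightarrow> qK x = qK y \<Longrightarrow> x = y"
  by (rule quat.expand) simp

lemma quat_eq_iff: "x = y \<longleftrightarrow> qRe x = qRe y \<and> qI x = qI y \<and> qJ x = qJ y \<and> qK x = qK y"
  by (auto intro: quat_eqI)

instantiation quat :: ab_group_add
begin

primcorec zero_quat where
  "qRe 0 = 0" | "qI 0 = 0" | "qJ 0 = 0" | "qK 0 = 0"

primcorec plus_quat where
  "qRe (x + y) = qRe x + qRe y"
| "qI (x + y) = qI x + qI y"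
| "qJ (x + y) = qJ x + qJ y"
| "qK (x + y) = qK x + qK y"

primcorec uminus_quat where
  "qRe (- x) = - qRe x"
| "qI (- x) = - qI x"
| "qJ (- x) = - qJ x"
| "qK (- x) = - qK x"

primcorec minus_quat where
  "qRe (x - y) = qRe x - qRe y"
| "qI (x - y) = qI x - qI y"
| "qJ (x - y) = qJ x - qJ y"
| "qK (x - y) = qK x - qK y"

instance
  by standard (simp_all add: quat_eq_iff)

end

instantiation quat :: real_vector
begin

primcorec scaleR_quat where
  "qRe (scaleR r x) = r * qRe x"
| "qI (scaleR r x) = r * qI x"
| "qJ (scaleR r x) = r * qJ x"
| "qK (scaleR r x) = r * qK x"

instance
  by standard (simp_all add: quat_eq_iff algebra_simps)

end

instantiation quat :: ring_1
begin

primcorec one_quat where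
  "qRe 1 = 1" | "qI 1 = 0" | "qJ 1 = 0" | "qK 1 = 0"

primcorec times_quat where
  "qRe (x * y) = qRe x * qRe y - qI x * qI y - qJ x * qJ y - qK x * qK y"
| "qI (x * y) = qRe x * qI y + qI x * qRe y + qJ x * qK y - qK x * qJ y"
| "qJ (x * y) = qRe x * qJ y - qI x * qK y + qJ x * qRe y + qK x * qI y"
| "qK (x * y) = qRe x * qK y + qI x * qJ y - qJ x * qI y + qK x * qRe y"

instance
  by standard (simp_all add: quat_eq_iff algebra_simps)

end

lemma quat_units:
  defines "i \<equiv> Quat 0 1 0 0" and "j \<equiv> Quat 0 0 1 0" and "k \<equiv> Quat 0 0 0 1"
  shows "i * i = -1" and "j * j = -1" and "k * k = -1" and "i * j * k = -1"
  by (simp_all add: i_def j_def k_def quat_eq_iff)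

instantiation quat :: real_inner
begin

definition inner_quat :: "quat \<Rightarrow> quat \<Rightarrow> real" where
  "inner x y = qRe x * qRe y + qI x * qI y + qJ x * qJ y + qK x * qK y"

definition norm_quat :: "quat \<Rightarrow> real" where
  "norm x = sqrt ((qRe x)\<^sup>2 + (qI x)\<^sup>2 + (qJ x)\<^sup>2 + (qK x)\<^sup>2)"

definition sgn_quat :: "quat \<Rightarrow> quat" where
  "sgn x = x /\<^sub>R norm x" for x :: quat

definition dist_quat :: "quat \<Rightarrow> quat \<Rightarrow> real" where
  "dist x y = norm (x - y)" for x y :: quat

definition uniformity_quat :: "(quat \<times> quat) filter" where
  "(uniformity :: (quat \<times> quat) filter) = (INF e\<in>{0 <..}. principal {(x, y). dist x y < e})"

definition open_quat :: "quat set \<Rightarrow> bool" where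
  "open U \<longleftrightarrow> (\<forall>x\<in>U. eventually (\<lambda>(x', y). x' = x \<longrightarrow> y \<in> U) uniformity)" for U :: "quat set"

instance
proof
  fix x y z :: quat and r :: real and U :: "quat set"
  show "dist x y = norm (x - y)" by (rule dist_quat_def)
  show "sgn x = x /\<^sub>R norm x" by (rule sgn_quat_def)
  show "(uniformity :: (quat \<times> quat) filter) = (INF e\<in>{0 <..}. principal {(x, y). dist x y < e})"
    by (rule uniformity_quat_def)
  show "open U \<longleftrightarrow> (\<forall>x\<in>U. eventually (\<lambda>(x', y). x' = x \<longrightarrow> y \<in> U) uniformity)"
    by (rule open_quat_def)
  show "inner x y = inner y x" by (simp add: inner_quat_def)
  show "inner (x + y) z = inner x z + inner y z" by (simp add: inner_quat_def algebra_simps)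
  show "inner (scaleR r x) y = r * inner x y" by (simp add: inner_quat_def algebra_simps)
  show "0 \<le> inner x x" by (simp add: inner_quat_def)
  show "inner x x = 0 \<longleftrightarrow> x = 0"
    by (auto simp: inner_quat_def quat_eq_iff add_nonneg_eq_0_iff)
  show "norm x = sqrt (inner x x)" by (simp add: inner_quat_def norm_quat_def power2_eq_square)
qed

end

instance quat :: real_normed_algebra_1
proof
  fix x y :: quat and r :: real
  show "scaleR r x * y = scaleR r (x * y)" by (simp add: quat_eq_iff algebra_simps)
  show "x * scaleR r y = scaleR r (x * y)" by (simp add: quat_eq_iff algebra_simps)
  show "norm (1 :: quat) = 1" by (simp add: norm_quat_def)
  have "(norm (x * y))\<^sup>2 = (norm x * norm y)\<^sup>2"
    by (simp add: norm_quat_def power_mult_distrib) (simp add: power2_eq_square algebra_simps)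
  then have "norm (x * y) = norm x * norm y"
    by (simp add: power2_eq_iff_nonneg)
  then show "norm (x * y) \<le> norm x * norm y" by simp
qed

instantiation quat :: division_ring
begin

text \<open>The inverse of \<open>x\<close> is its conjugate divided by \<open>(norm x)\<^sup>2\<close>.\<close>

definition inverse_quat :: "quat \<Rightarrow> quat" where
  "inverse x = Quat (qRe x) (- qI x) (- qJ x) (- qK x) /\<^sub>R (norm x)\<^sup>2"

definition divide_quat :: "quat \<Rightarrow> quat \<Rightarrow> quat" where
  "x div y = x * inverse y" for x y :: quat

instance
proof
  fix x y :: quat
  show "x div y = x * inverse y" by (rule divide_quat_def)
  show "inverse (0 :: quat) = 0" by (simp add: inverse_quat_def)
  have n: "(norm x)\<^sup>2 = qRe x * qRe x + qI x * qI x + qJ x * qJ x + qK x * qK x"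
    by (simp add: norm_quat_def power2_eq_square)
  show "inverse x * x = 1" if "x \<noteq> 0"
  proof -
    from that have "(norm x)\<^sup>2 \<noteq> 0" by simp
    then show ?thesis
      by (auto simp: inverse_quat_def quat_eq_iff n field_simps)
  qed
  show "x * inverse x = 1" if "x \<noteq> 0"
  proof -
    from that have "(norm x)\<^sup>2 \<noteq> 0" by simp
    then show ?thesis
      by (auto simp: inverse_quat_def quat_eq_iff n field_simps)
  qed
qed

end

instance quat :: real_normed_div_algebra
proof
  fix x y :: quat
  have "(norm (x * y))\<^sup>2 = (norm x * norm y)\<^sup>2"
    by (simp add: norm_quat_def power_mult_distrib) (simp add: power2_eq_square algebra_simps)
  then show "norm (x * y) = norm x * norm y"
    by (simp add: power2_eq_iff_nonneg)
qed

definition quat_k :: quat where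
  "quat_k = Quat 0 0 0 1"

definition quat_of_complex :: "complex \<Rightarrow> quat" where
  "quat_of_complex z = Quat (Re z) (Im z) 0 0"

lemma quat_complex_decomposition:
  "\<exists>!p. q = quat_of_complex (fst p) + quat_k * quat_of_complex (snd p)"
proof
  show "q = quat_of_complex (fst (Complex (qRe q) (qI q), Complex (qK q) (qJ q)))
          + quat_k * quat_of_complex (snd (Complex (qRe q) (qI q), Complex (qK q) (qJ q)))"
    by (simp add: quat_eq_iff quat_k_def quat_of_complex_def)
qed (auto simp: quat_eq_iff quat_k_def quat_of_complex_def complex_eq_iff prod_eq_iff)

text \<open>Over a noncommutative ring only the additive structure of \<open>'a poly\<close> is available, and
  \<open>poly\<close> (Horner evaluation) is not; coefficients are written to the left of the powers.\<close>

definition qpoly_eval :: "quat poly \<Rightarrow> quat \<Rightarrow> quat" where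
  "qpoly_eval P q = (\<Sum>i\<le>degree P. coeff P i * q ^ i)"

definition is_root :: "quat poly \<Rightarrow> quat \<Rightarrow> bool" where
  "is_root P q \<longleftrightarrow> qpoly_eval P q = 0"

definition congruence_class :: "quat \<Rightarrow> quat set" where
  "congruence_class q = {w * q * inverse w | w. w \<noteq> 0}"

definition spherical_root :: "quat poly \<Rightarrow> quat \<Rightarrow> bool" where
  "spherical_root P q \<longleftrightarrow> is_root P q \<and> q \<notin> \<real> \<and> (\<forall>r\<in>congruence_class q. is_root P r)"

definition isolated_root :: "quat poly \<Rightarrow> quat \<Rightarrow> bool" where
  "isolated_root P q \<longleftrightarrow> is_root P q \<and> \<not> spherical_root P q"

text \<open>Intended for \<open>P \<noteq> 0\<close>.\<close>

definition height :: "'a::real_normed_vector poly \<Rightarrow> real" where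
  "height P = Max (insert 1 {norm (coeff P i) / norm (lead_coeff P) | i. i < degree P})"

end

theory Submission
  imports Defs
begin

text \<open>A complex root \<open>z\<close> of \<open>Q = f + k g\<close> is a common root of \<open>f\<close> and \<open>g\<close>, so Cauchy's bound
  applies to either of them. The class of a spherical root contains a pair of conjugate nonreal
  numbers \<open>z\<close>, \<open>cnj z\<close> of the same norm \<open>r\<close>; both are roots of \<open>f\<close> and \<open>g\<close>, hence of all four real
  components \<open>h\<close>. If \<open>r > 1\<close>, dividing a polynomial by \<open>t - w\<close> with \<open>norm w = r\<close> from the constant
  term upwards increases a bound for its coefficients at most by the factor \<open>1 / (r - 1)\<close>. Dividing
  \<open>h\<close> by both \<open>t - z\<close> and \<open>t - cnj z\<close> leaves the leading coefficient unchanged, which gives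
  \<open>(r - 1)\<^sup>2 < height h\<close>.\<close>

subsection \<open>Cauchy bounds\<close>

lemma height_ge_1: "1 \<le> height P"
  unfolding height_def by (rule Max_ge) auto

lemma norm_coeff_le_height:
  fixes P :: "'a::real_normed_vector poly"
  assumes "i < degree P"
  shows "norm (coeff P i) \<le> height P * norm (lead_coeff P)"
proof -
  have "norm (coeff P i) / norm (lead_coeff P) \<le> height P"
    unfolding height_def using assms by (intro Max_ge) auto
  moreover have "lead_coeff P \<noteq> 0"
    using assms by auto
  ultimately show ?thesis
    by (simp add: divide_le_eq)
qed

text \<open>The leading term equals minus the sum of the lower ones, which a geometric series in
  \<open>norm x\<close> dominates. Stating the root as an explicit sum over a division algebra
  covers the quaternionic \<open>Q\<close> as well as the complex \<open>f\<close> and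
  \<open>g\<close>.\<close>

lemma cauchy_bound:
  fixes P :: "'a::real_normed_div_algebra poly"
  assumes "P \<noteq> 0" and root: "(\<Sum>i\<le>degree P. coeff P i * x ^ i) = 0"
  shows "norm x < 1 + height P"
proof (cases "norm x \<le> 1")
  case True
  then show ?thesis
    using height_ge_1[of P] by linarith
next
  case False
  define n L r where "n = degree P" and "L = norm (lead_coeff P)" and "r = norm x"
  have "L > 0" "r > 1" "height P > 0"
    using assms False height_ge_1[of P] by (auto simp: L_def r_def)
  have "lead_coeff P * x ^ n = - (\<Sum>i<n. coeff P i * x ^ i)"
    using root by (simp add: n_def lessThan_Suc_atMost[symmetric] add_eq_0_iff)
  then have "L * r ^ n = norm (\<Sum>i<n. coeff P i * x ^ i)"
    by (metis L_def r_def norm_mult norm_power norm_minus_cancel)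
  also have "\<dots> \<le> (\<Sum>i<n. height P * L * r ^ i)"
    by (rule sum_norm_le)
      (auto simp: norm_mult norm_power L_def r_def n_def intro!: mult_right_mono norm_coeff_le_height)
  also have "\<dots> = height P * L * ((r ^ n - 1) / (r - 1))"
    using \<open>r > 1\<close> by (simp add: sum_distrib_left[symmetric] geometric_sum)
  \<comment> \<open>Dropping the \<open>- 1\<close> makes the final bound strict.\<close>
  also have "\<dots> < height P * L * (r ^ n / (r - 1))"
    using \<open>L > 0\<close> \<open>r > 1\<close> \<open>height P > 0\<close>
    by (intro mult_strict_left_mono divide_strict_right_mono) auto
  finally have "L * r ^ n * (r - 1) < L * r ^ n * height P"
    using \<open>r > 1\<close> by (simp add: field_simps)
  then have "r - 1 < height P"
    using \<open>L > 0\<close> \<open>r > 1\<close> by (subst (asm) mult_less_cancel_left_pos) auto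
  then show ?thesis
    by (simp add: r_def)
qed

text \<open>Comparing coefficients bounds each \<open>norm (coeff q j)\<close> by
  \<open>(x + B) / norm w\<close>, where \<open>x\<close> bounds the preceding coefficient. The
  bound \<open>B / (norm w - 1)\<close> is the fixed point of this recursion.\<close>

lemma norm_coeff_quotient_less:
  fixes q :: "'a::real_normed_field poly"
  assumes w: "1 < norm w" and "0 < B"
    and le: "\<And>j. j \<le> m \<Longrightarrow> norm (coeff ([:- w, 1:] * q) j) \<le> B"
  shows "j \<le> m \<Longrightarrow> norm (coeff q j) < B / (norm w - 1)"
proof (induction j)
  case 0
  have "norm w * norm (coeff q 0) \<le> B"
    using le[of 0] by (simp add: norm_mult)
  then have "norm (coeff q 0) \<le> B / norm w"
    by (subst pos_le_divide_eq) (use w in \<open>auto simp: mult.commute\<close>)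
  also have "\<dots> < B / (norm w - 1)"
    using w \<open>0 < B\<close> by (intro divide_strict_left_mono mult_pos_pos) auto
  finally show ?case .
next
  case (Suc j)
  have "w * coeff q (Suc j) = coeff q j - coeff ([:- w, 1:] * q) (Suc j)"
    by simp
  then have "norm w * norm (coeff q (Suc j)) \<le> norm (coeff q j) + norm (coeff ([:- w, 1:] * q) (Suc j))"
    by (metis norm_mult norm_triangle_ineq4)
  also have "\<dots> < B / (norm w - 1) + B"
    using Suc le[of "Suc j"] by (intro add_less_le_mono) auto
  also have "\<dots> = norm w * (B / (norm w - 1))"
    using w by (simp add: field_simps)
  finally show ?case
    using w by (subst (asm) mult_less_cancel_left_pos) auto
qed

lemma two_factors_bound:
  fixes s :: "'a::real_normed_field poly"
  assumes p: "p = [:- z, 1:] * ([:- w, 1:] * s)" and "s \<noteq> 0" and z: "1 < norm z" and w: "1 < norm w"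
  shows "(norm z - 1) * (norm w - 1) < height p"
proof -
  define L where "L = norm (lead_coeff p)"
  have "degree p = degree s + 2"
    using \<open>s \<noteq> 0\<close> by (simp add: p degree_mult_eq del: mult_pCons_left)
  have L: "L = norm (coeff s (degree s))"
    unfolding L_def p lead_coeff_mult by simp
  have "L > 0"
    using L \<open>s \<noteq> 0\<close> by simp
  have "0 < height p"
    using height_ge_1[of p] by linarith
  \<comment> \<open>Indices up to \<open>degree s\<close> stay below \<open>degree p\<close>, where
    the height controls the coefficients.\<close>
  have "norm (coeff ([:- w, 1:] * s) j) < height p * L / (norm z - 1)" if "j \<le> degree s" for j
  proof (rule norm_coeff_quotient_less[OF z _ _ that])
    show "norm (coeff ([:- z, 1:] * ([:- w, 1:] * s)) j) \<le> height p * L" if "j \<le> degree s" for j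
      using norm_coeff_le_height[of j p] that \<open>degree p = degree s + 2\<close> by (simp only: L_def p)
  qed (use \<open>L > 0\<close> \<open>0 < height p\<close> in simp)
  \<comment> \<open>At index \<open>degree s\<close> the second division bounds the leading
    coefficient of \<open>s\<close>, whose norm is \<open>L\<close> itself.\<close>
  then have "L < height p * L / (norm z - 1) / (norm w - 1)"
    unfolding L using \<open>L > 0\<close> \<open>0 < height p\<close> z
    by (intro norm_coeff_quotient_less[OF w, where m = "degree s"]) (auto intro: less_imp_le simp: L)
  then have "L * ((norm z - 1) * (norm w - 1)) < L * height p"
    using z w by (simp add: pos_less_divide_eq mult_ac)
  then show ?thesis
    using \<open>L > 0\<close> by simp
qed

lemma height_map_poly_of_real:
  "height (map_poly of_real h :: 'a::{real_normed_algebra_1} poly) = height h"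
  by (simp add: height_def coeff_map_poly degree_map_poly)

lemma nonreal_root_bound:
  fixes h :: "real poly" and z :: complex
  assumes "h \<noteq> 0" and root: "poly (map_poly of_real h) z = 0" and "Im z \<noteq> 0"
  shows "norm z < 1 + sqrt (height h)"
proof (cases "norm z \<le> 1")
  case True
  moreover have "0 < sqrt (height h)"
    using height_ge_1[of h] by simp
  ultimately show ?thesis
    by linarith
next
  case False
  define p :: "complex poly" where "p = map_poly of_real h"
  have "p \<noteq> 0"
    using \<open>h \<noteq> 0\<close> by (simp add: p_def map_poly_eq_0_iff)
  obtain q where q: "p = [:- z, 1:] * q"
    using root by (auto simp: p_def poly_eq_0_iff_dvd)
  have "poly p (cnj z) = cnj (poly p z)"
    by (rule poly_cnj_real[symmetric]) (simp add: p_def coeff_map_poly)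
  then have "(cnj z - z) * poly q (cnj z) = 0"
    using root by (simp add: p_def[symmetric]) (auto simp: q)
  then have "poly q (cnj z) = 0"
    using \<open>Im z \<noteq> 0\<close> by (auto simp: complex_eq_iff)
  then obtain s where s: "q = [:- cnj z, 1:] * s"
    by (auto simp: poly_eq_0_iff_dvd)
  have "(norm z - 1) * (norm (cnj z) - 1) < height p"
  proof (rule two_factors_bound[OF q[unfolded s]])
    show "s \<noteq> 0"
      using \<open>p \<noteq> 0\<close> q s by auto
  qed (use False in auto)
  then have "(norm z - 1)\<^sup>2 < height h"
    by (simp add: p_def height_map_poly_of_real power2_eq_square)
  then have "norm z - 1 < sqrt (height h)"
    by (rule real_less_rsqrt)
  then show ?thesis
    by simp
qed

subsection \<open>Complex quaternions\<close>

lemma quat_of_complex_simps [simp]: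
  "quat_of_complex 0 = 0" "quat_of_complex 1 = 1"
  "quat_of_complex (x + y) = quat_of_complex x + quat_of_complex y"
  "quat_of_complex (x * y) = quat_of_complex x * quat_of_complex y"
  by (simp_all add: quat_eq_iff quat_of_complex_def)

lemma quat_of_complex_power [simp]: "quat_of_complex (x ^ n) = quat_of_complex x ^ n"
  by (induction n) simp_all

lemma quat_of_complex_sum [simp]: "quat_of_complex (sum h A) = (\<Sum>x\<in>A. quat_of_complex (h x))"
  by (induction A rule: infinite_finite_induct) simp_all

lemma norm_quat_of_complex [simp]: "norm (quat_of_complex z) = norm z"
  by (simp add: norm_quat_def quat_of_complex_def norm_complex_def)

text \<open>Left multiplication by \<open>quat_k\<close> carries the complex plane to the span of j
  and k, so the two summands cannot cancel.\<close>

lemma quat_of_complex_decomp_eq_0_iff: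
  "quat_of_complex x + quat_k * quat_of_complex y = 0 \<longleftrightarrow> x = 0 \<and> y = 0"
  by (auto simp: quat_eq_iff quat_k_def quat_of_complex_def complex_eq_iff)

lemma qpoly_eval_altdef:
  assumes "degree P \<le> n"
  shows "qpoly_eval P q = (\<Sum>i\<le>n. coeff P i * q ^ i)"
  unfolding qpoly_eval_def
  by (rule sum.mono_neutral_left) (use assms in \<open>auto simp: coeff_eq_0\<close>)

lemma poly_altdef_le:
  fixes p :: "'a::comm_semiring_1 poly"
  assumes "degree p \<le> n"
  shows "poly p x = (\<Sum>i\<le>n. coeff p i * x ^ i)"
  unfolding poly_altdef
  by (rule sum.mono_neutral_left) (use assms in \<open>auto simp: coeff_eq_0\<close>)

lemma qpoly_eval_complex:
  assumes Q: "Q = map_poly quat_of_complex f + map_poly (\<lambda>z. quat_k * quat_of_complex z) g"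
  shows "qpoly_eval Q (quat_of_complex z) = quat_of_complex (poly f z) + quat_k * quat_of_complex (poly g z)"
proof -
  \<comment> \<open>A common range of summation, padded with zero coefficients, lets the three
    evaluations be compared termwise.\<close>
  define n where "n = max (degree Q) (max (degree f) (degree g))"
  have "degree Q \<le> n" "degree f \<le> n" "degree g \<le> n"
    by (auto simp: n_def)
  moreover have "coeff Q i = quat_of_complex (coeff f i) + quat_k * quat_of_complex (coeff g i)" for i
    by (simp add: Q coeff_map_poly)
  ultimately show ?thesis
    by (simp add: qpoly_eval_altdef[of Q n] poly_altdef_le[of f n] poly_altdef_le[of g n]
        distrib_right mult.assoc sum.distrib sum_distrib_left)
qed

lemma is_root_complex_iff:
  assumes "Q = map_poly quat_of_complex f + map_poly (\<lambda>z. quat_k * quat_of_complex z) g"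
  shows "is_root Q (quat_of_complex z) \<longleftrightarrow> poly f z = 0 \<and> poly g z = 0"
  by (simp add: is_root_def qpoly_eval_complex[OF assms] quat_of_complex_decomp_eq_0_iff)

lemma conjugating_imp_congruent:
  assumes "w * q = p * w" and "w \<noteq> 0"
  shows "p \<in> congruence_class q"
proof -
  have "p = w * q * inverse w"
    using assms by (simp add: mult.assoc)
  then show ?thesis
    using \<open>w \<noteq> 0\<close> by (auto simp: congruence_class_def)
qed

text \<open>If \<open>u\<close> and \<open>v\<close> are imaginary of the same norm, then \<open>u\<^sup>2 = v\<^sup>2\<close>, so \<open>w = u + v\<close> satisfies
  \<open>w v = u w\<close>; the case \<open>u = - v\<close> needs a different conjugating element.\<close>

lemma complex_in_congruence_class:
  assumes b: "b\<^sup>2 = (qI q)\<^sup>2 + (qJ q)\<^sup>2 + (qK q)\<^sup>2"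
  shows "quat_of_complex (Complex (qRe q) b) \<in> congruence_class q"
proof (cases "b + qI q = 0 \<and> qJ q = 0 \<and> qK q = 0")
  case True
  \<comment> \<open>Here \<open>q\<close> is the complex conjugate of the target, and j anticommutes
    with i.\<close>
  then have "Quat 0 0 1 0 * q = quat_of_complex (Complex (qRe q) b) * Quat 0 0 1 0"
    by (simp add: quat_eq_iff quat_of_complex_def)
  then show ?thesis
    by (rule conjugating_imp_congruent) (simp add: quat_eq_iff)
next
  case False
  have "Quat 0 (b + qI q) (qJ q) (qK q) * q
      = quat_of_complex (Complex (qRe q) b) * Quat 0 (b + qI q) (qJ q) (qK q)"
    using b by (simp add: quat_eq_iff quat_of_complex_def algebra_simps power2_eq_square)
  then show ?thesis
    by (rule conjugating_imp_congruent) (use False in \<open>auto simp: quat_eq_iff\<close>)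
qed

text \<open>With \<open>x\<close>, \<open>y\<close> the values of the parts at \<open>z\<close>,
  conjugating the equation at \<open>cnj z\<close> gives \<open>x - \<i> * y = 0\<close> next to
  \<open>x + \<i> * y = 0\<close>.\<close>

lemma poly_re_im_parts_eq_0:
  fixes f1 f2 :: "real poly"
  assumes f: "f = map_poly of_real f1 + smult \<i> (map_poly of_real f2)"
    and "poly f z = 0" and "poly f (cnj z) = 0"
  shows "poly (map_poly of_real f1) z = 0 \<and> poly (map_poly of_real f2) z = 0"
proof -
  have cnj: "poly (map_poly of_real h) (cnj z) = cnj (poly (map_poly of_real h) z)" for h :: "real poly"
    by (rule poly_cnj_real[symmetric]) (simp add: coeff_map_poly)
  define x y where "x = poly (map_poly of_real f1) z" and "y = poly (map_poly of_real f2) z"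
  have "x + \<i> * y = 0" "cnj x + \<i> * cnj y = 0"
    using assms by (simp_all add: x_def y_def cnj)
  then have "x = 0 \<and> y = 0"
    by (auto simp: complex_eq_iff)
  then show ?thesis
    by (simp add: x_def y_def)
qed

theorem theorem5:
  fixes Q :: "quat poly" and f g :: "complex poly" and f1 f2 g1 g2 :: "real poly"
    and H1 H2 :: real and \<rho> :: quat
  assumes monic: "lead_coeff Q = 1"
    and Q: "Q = map_poly quat_of_complex f + map_poly (\<lambda>z. quat_k * quat_of_complex z) g"
    and f: "f = map_poly of_real f1 + smult \<i> (map_poly of_real f2)"
    and g: "g = map_poly of_real g1 + smult \<i> (map_poly of_real g2)"
    and H1: "H1 = Min (height ` ({f, g} - {0}))"
    and H2: "H2 = Min (height ` ({f1, f2, g1, g2} - {0}))"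
    and root: "is_root Q \<rho>"
  shows "(spherical_root Q \<rho> \<longrightarrow> norm \<rho> < 1 + sqrt H2)
       \<and> (isolated_root Q \<rho> \<and> \<rho> \<in> range quat_of_complex \<longrightarrow> norm \<rho> < 1 + H1)
       \<and> norm \<rho> < 1 + height Q"
proof -
  have "Q \<noteq> 0"
    using monic by auto
  \<comment> \<open>\<open>Min\<close> is only meaningful on nonempty sets.\<close>
  then have "{f, g} - {0} \<noteq> {}"
    using Q by auto
  then have "{f1, f2, g1, g2} - {0} \<noteq> {}"
    using f g by auto
  have "norm \<rho> < 1 + sqrt H2" if sph: "spherical_root Q \<rho>"
  proof -
    \<comment> \<open>The norm of the imaginary part of \<open>\<rho>\<close>; the signs
      \<open>b\<close> and \<open>- b\<close> give the two complex members of its class.\<close>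
    define b where "b = sqrt ((qI \<rho>)\<^sup>2 + (qJ \<rho>)\<^sup>2 + (qK \<rho>)\<^sup>2)"
    define z where "z = Complex (qRe \<rho>) b"
    have b: "b\<^sup>2 = (qI \<rho>)\<^sup>2 + (qJ \<rho>)\<^sup>2 + (qK \<rho>)\<^sup>2"
      by (simp add: b_def)
    have "norm \<rho> = norm z"
      by (simp add: norm_quat_def norm_complex_def z_def b)
    have "Im z \<noteq> 0"
    proof
      assume "Im z = 0"
      then have "\<rho> = of_real (qRe \<rho>)"
        using b by (simp add: z_def quat_eq_iff of_real_def add_nonneg_eq_0_iff)
      then show False
        using sph by (metis Reals_of_real spherical_root_def)
    qed
    have "quat_of_complex z \<in> congruence_class \<rho>" "quat_of_complex (cnj z) \<in> congruence_class \<rho>"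
      using complex_in_congruence_class[of b \<rho>] complex_in_congruence_class[of "- b" \<rho>] b
      by (auto simp: z_def complex_cnj)
    then have "is_root Q (quat_of_complex z)" "is_root Q (quat_of_complex (cnj z))"
      using sph by (auto simp: spherical_root_def)
    then have roots: "poly (map_poly of_real h) z = 0" if "h \<in> {f1, f2, g1, g2}" for h
      using that poly_re_im_parts_eq_0[OF f, of z] poly_re_im_parts_eq_0[OF g, of z]
      by (auto simp: is_root_complex_iff[OF Q])
    \<comment> \<open>All four components vanish at \<open>z\<close>, so the bound can be applied to
      a nonzero one of least height.\<close>
    have "H2 \<in> height ` ({f1, f2, g1, g2} - {0})"
      unfolding H2 using \<open>{f1, f2, g1, g2} - {0} \<noteq> {}\<close> by (intro Min_in) auto
    then obtain h where "h \<in> {f1, f2, g1, g2}" "h \<noteq> 0" "H2 = height h"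
      by blast
    then show ?thesis
      using nonreal_root_bound[of h z] roots \<open>Im z \<noteq> 0\<close> \<open>norm \<rho> = norm z\<close> by simp
  qed
  moreover have "norm \<rho> < 1 + H1" if "\<rho> \<in> range quat_of_complex"
  proof -
    obtain z where z: "\<rho> = quat_of_complex z"
      using \<open>\<rho> \<in> range quat_of_complex\<close> by blast
    have "H1 \<in> height ` ({f, g} - {0})"
      unfolding H1 using \<open>{f, g} - {0} \<noteq> {}\<close> by (intro Min_in) auto
    then obtain h where "h \<in> {f, g}" "h \<noteq> 0" "H1 = height h"
      by blast
    moreover have "poly h z = 0"
      using root \<open>h \<in> {f, g}\<close> by (auto simp: z is_root_complex_iff[OF Q])
    ultimately show ?thesis
      using cauchy_bound[of h z] by (simp add: z poly_altdef)
  qed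
  moreover have "norm \<rho> < 1 + height Q"
    using cauchy_bound[OF \<open>Q \<noteq> 0\<close>] root by (simp add: is_root_def qpoly_eval_def)
  ultimately show ?thesis
    by blast
qed

end
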